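(* Let $G$ be a labeled acyclic digraph and $x<y$ vertices of $G$. Then $$\Delta(\Psi([x,y]))=\sum_{x<z<y}\Psi([x,z])\otimes\Psi([z,y]).$$
   Context: A labeled acyclic digraph $G=(V,E)$ is a directed graph (multiple edges allowed) with no directed cycles, locally finite (finitely many directed paths between any two vertices), with a set $\Lambda$ carrying an arbitrary binary relation $\sim$ and a labeling $\lambda:E\to\Lambda$. A path $(e_1,\dots,e_k)$ from $x$ to $y$ satisfies $\operatorname{tail}(e_1)=x$, $\operatorname{head}(e_k)=y$, $\operatorname{head}(e_i)=\operatorname{tail}(e_{i+1})$. $x\le y$ means there is a path from $x$ to $y$; $[x,y]=\{z:x\le z\le y\}$ as induced labeled subgraph. For a path $p=(e_1,\dots,e_k)$, $k\ge1$, the descent word is $u(p)=u_1\cdots u_{k-1}\in\mathbb{Z}\langle{\bf a},{\bf b}\rangle$ (non-commuting variables) with $u_i={\bf a}$ if $\lambda(e_i)\sim\lambda(e_{i+1})$ and $u_i={\bf b}$ otherwise; for $x<y$, $\Psi([x,y])=\sum_p u(p)$ over all paths from $x$ to $y$. The coproduct $\Delta:\mathbb{Z}\langle{\bf a},{\bf b}\rangle\to\mathbb{Z}\langle{\bf a},{\bf b}\rangle\otimes\mathbb{Z}\langle{\bf a},{\bf b}\rangle$ is the linear map with $\Delta(u_1u_2\cdots u_n)=\sum_{i=1}^n u_1\cdots u_{i-1}\otimes u_{i+1}\cdots u_n$ for monomials ($u_j\in\{{\bf a},{\bf b}\}$), so $\Delta(1)=0$. *)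

theory Defs
  imports "Graph_Theory.Digraph_Component" "HOL-Library.Poly_Mapping" "HOL-Library.Product_Plus"
begin

section \<open>The ring of non-commutative polynomials in a and b\<close>

datatype ab_letter = A | B

text \<open>The free monoid on the two letters, written additively (addition is concatenation,
  zero is the empty word), because \<open>\<Rightarrow>\<^sub>0\<close> carries the convolution product of the monoid ring
  for additive index monoids.\<close>

datatype ab_word = Word (letters: "ab_letter list")

instantiation ab_word :: monoid_add
begin

definition zero_ab_word :: ab_word where
  "0 = Word []"

definition plus_ab_word :: "ab_word \<Rightarrow> ab_word \<Rightarrow> ab_word" where
  "v + w = Word (letters v @ letters w)"

instance
  by standard (auto simp: zero_ab_word_def plus_ab_word_def)

end

type_synonym ab_poly = "ab_word \<Rightarrow>\<^sub>0 int"

definition ab_var :: "ab_letter \<Rightarrow> ab_poly" where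
  "ab_var l = Poly_Mapping.single (Word [l]) 1"

text \<open>The tensor square over the integers. Since \<open>ab_poly\<close> is the free abelian group on the words,
  its tensor square is the free abelian group on the pairs of words, the pair \<open>(v, w)\<close> being
  the tensor of the monomials \<open>v\<close> and \<open>w\<close>.\<close>

type_synonym ab_poly2 = "(ab_word \<times> ab_word) \<Rightarrow>\<^sub>0 int"

definition tensor :: "ab_poly \<Rightarrow> ab_poly \<Rightarrow> ab_poly2"  (infixl \<open>\<otimes>\<close> 70) where
  "f \<otimes> g = (\<Sum>v\<in>Poly_Mapping.keys f. \<Sum>w\<in>Poly_Mapping.keys g.
     Poly_Mapping.single (v, w) (Poly_Mapping.lookup f v * Poly_Mapping.lookup g w))"

text \<open>Positions are counted from 0 here: the summand \<open>i\<close> deletes the letter at position \<open>i\<close>.\<close>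

definition coproduct :: "ab_poly \<Rightarrow> ab_poly2"  (\<open>\<Delta>\<close>) where
  "\<Delta> f = (\<Sum>w\<in>Poly_Mapping.keys f. \<Sum>i<length (letters w).
     Poly_Mapping.single (Word (take i (letters w)), Word (drop (Suc i) (letters w)))
       (Poly_Mapping.lookup f w))"

text \<open>The defining properties of \<open>\<otimes>\<close> and \<open>\<Delta>\<close>: additivity (hence linearity over the integers)
  and the values on monomials.\<close>

lemma prod_list_ab_var: "prod_list (map ab_var ls) = Poly_Mapping.single (Word ls) 1"
  by (induction ls)
    (simp_all add: ab_var_def mult_single plus_ab_word_def single_one flip: zero_ab_word_def)

lemma sum_keys_superset:
  fixes f :: "'a \<Rightarrow>\<^sub>0 int" and F :: "'a \<Rightarrow> int \<Rightarrow> 'b::comm_monoid_add"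
  assumes "finite S" "Poly_Mapping.keys f \<subseteq> S" "\<And>v. F v 0 = 0"
  shows "(\<Sum>v\<in>Poly_Mapping.keys f. F v (Poly_Mapping.lookup f v))
    = (\<Sum>v\<in>S. F v (Poly_Mapping.lookup f v))"
  using assms by (intro sum.mono_neutral_left) (auto simp: in_keys_iff)

lemma sum_keys_add:
  fixes f g :: "'a \<Rightarrow>\<^sub>0 int" and F :: "'a \<Rightarrow> int \<Rightarrow> 'b::comm_monoid_add"
  assumes add: "\<And>v c d. F v (c + d) = F v c + F v d" and zero: "\<And>v. F v 0 = 0"
  shows "(\<Sum>v\<in>Poly_Mapping.keys (f + g). F v (Poly_Mapping.lookup (f + g) v))
    = (\<Sum>v\<in>Poly_Mapping.keys f. F v (Poly_Mapping.lookup f v))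
      + (\<Sum>v\<in>Poly_Mapping.keys g. F v (Poly_Mapping.lookup g v))"
proof -
  let ?S = "Poly_Mapping.keys f \<union> Poly_Mapping.keys g"
  have "Poly_Mapping.keys (f + g) \<subseteq> ?S"
    by (rule keys_add)
  then show ?thesis
    using sum_keys_superset[of ?S "f + g" F] sum_keys_superset[of ?S f F]
      sum_keys_superset[of ?S g F]
    by (simp add: zero lookup_add add sum.distrib)
qed

lemma tensor_add_left: "(f + g) \<otimes> h = f \<otimes> h + g \<otimes> h"
  unfolding tensor_def
  by (rule sum_keys_add) (simp_all add: distrib_right single_add sum.distrib)

lemma tensor_add_right: "f \<otimes> (g + h) = f \<otimes> g + f \<otimes> h"
  unfolding tensor_def sum.distrib[symmetric]
  by (intro sum.cong refl sum_keys_add) (simp_all add: distrib_left single_add)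

lemma coproduct_add: "\<Delta> (f + g) = \<Delta> f + \<Delta> g"
  unfolding coproduct_def by (rule sum_keys_add) (simp_all add: single_add sum.distrib)

lemma coproduct_monomial:
  "\<Delta> (prod_list (map ab_var ls)) =
    (\<Sum>i<length ls. prod_list (map ab_var (take i ls)) \<otimes> prod_list (map ab_var (drop (Suc i) ls)))"
  by (simp add: prod_list_ab_var coproduct_def tensor_def)


section \<open>Labeled acyclic digraphs\<close>

text \<open>Parallel arcs are allowed, and \<open>awalk x p y\<close> says that the list \<open>p\<close> of arcs is a directed
  path from \<open>x\<close> to \<open>y\<close>; the empty list is a path from each vertex to itself. The labeling is an
  arbitrary function \<open>lab\<close> from the arcs to a type of labels, which carries an arbitrary binary
  relation \<open>rel\<close>. As nothing is required of them, they are separate arguments below.\<close>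

locale acyclic_digraph = wf_digraph +
  assumes acyclic: "\<not> cycle p"
    and locally_finite: "finite {p. awalk x p y}"

definition path_le :: "('v, 'e) pre_digraph \<Rightarrow> 'v \<Rightarrow> 'v \<Rightarrow> bool" where
  "path_le G x y \<longleftrightarrow> (\<exists>p. pre_digraph.awalk G x p y)"

definition path_less :: "('v, 'e) pre_digraph \<Rightarrow> 'v \<Rightarrow> 'v \<Rightarrow> bool" where
  "path_less G x y \<longleftrightarrow> path_le G x y \<and> x \<noteq> y"

definition interval :: "('v, 'e) pre_digraph \<Rightarrow> 'v \<Rightarrow> 'v \<Rightarrow> ('v, 'e) pre_digraph" where
  "interval G x y = G \<restriction> {z. path_le G x z \<and> path_le G z y}"

text \<open>Only meaningful for nonempty paths.\<close>

definition descent_word :: "('e \<Rightarrow> 'l) \<Rightarrow> ('l \<Rightarrow> 'l \<Rightarrow> bool) \<Rightarrow> 'e list \<Rightarrow> ab_poly" where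
  "descent_word lab rel p =
    (\<Prod>i\<leftarrow>[0..<length p - 1]. if rel (lab (p ! i)) (lab (p ! Suc i)) then ab_var A else ab_var B)"

text \<open>\<open>ab_index G lab rel x y\<close> is \<open>\<Psi>([x,y])\<close>, for \<open>x\<close> smaller than \<open>y\<close>. The sum runs over the
  paths of the digraph \<open>[x,y]\<close>, with the labels restricted from those of \<open>G\<close>; these are the paths
  of \<open>G\<close> from \<open>x\<close> to \<open>y\<close>, as the next lemma shows.\<close>

definition ab_index ::
  "('v, 'e) pre_digraph \<Rightarrow> ('e \<Rightarrow> 'l) \<Rightarrow> ('l \<Rightarrow> 'l \<Rightarrow> bool) \<Rightarrow> 'v \<Rightarrow> 'v \<Rightarrow> ab_poly" where
  "ab_index G lab rel x y =
    (\<Sum>p | pre_digraph.awalk (interval G x y) x p y. descent_word lab rel p)"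

lemma (in wf_digraph) awalk_interval_iff:
  "pre_digraph.awalk (interval G x y) x p y \<longleftrightarrow> awalk x p y"
proof -
  have cas_eq: "pre_digraph.cas (interval G x y) u q v \<longleftrightarrow> cas u q v" for u q v
    by (induction q arbitrary: u) (simp_all add: interval_def pre_digraph.cas.simps)
  show ?thesis
  proof
    assume "pre_digraph.awalk (interval G x y) x p y"
    then have "cas x p y" "set p \<subseteq> arcs G" "path_le G x x"
      by (auto simp: pre_digraph.awalk_def cas_eq) (auto simp: interval_def)
    then show "awalk x p y"
      by (auto simp: awalk_def path_le_def)
  next
    assume w: "awalk x p y"
    have mid: "path_le G x z \<and> path_le G z y" if "z \<in> set (awalk_verts x p)" for z
      using awalk_decomp[OF w that] unfolding path_le_def by blast
    have "tail G e \<in> set (awalk_verts x p) \<and> head G e \<in> set (awalk_verts x p)"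
      if "e \<in> set p" for e
      using awalk_verts_arc1[OF that] awalk_verts_arc2[OF _ that] w by auto
    moreover have "x \<in> set (awalk_verts x p)"
      by (metis awhd_of_awalk awalk_verts_non_Nil hd_in_set w)
    ultimately show "pre_digraph.awalk (interval G x y) x p y"
      using w mid by (auto simp: pre_digraph.awalk_def cas_eq) (auto simp: interval_def)
  qed
qed

end

theory Submission
  imports Defs
begin

text \<open>Deleting the letter at position \<open>i\<close> of the descent word of a path \<open>p\<close> leaves the descent words
  of the two paths obtained by cutting \<open>p\<close> at its \<open>i\<close>-th inner vertex \<open>z\<close>. Both sides are
  therefore sums over the pairs of a path from \<open>x\<close> to \<open>y\<close> and one of its inner vertices;
  acyclicity is what makes the inner vertices differ from \<open>x\<close> and \<open>y\<close>.\<close>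

text \<open>The word as a list rather than a ring product, so that \<open>coproduct_monomial\<close>
  applies and deleting a letter becomes \<open>take\<close> and \<open>drop\<close>.\<close>

definition descent_letters :: "('e \<Rightarrow> 'l) \<Rightarrow> ('l \<Rightarrow> 'l \<Rightarrow> bool) \<Rightarrow> 'e list \<Rightarrow> ab_letter list" where
  "descent_letters lab rel p =
    map (\<lambda>i. if rel (lab (p ! i)) (lab (p ! Suc i)) then A else B) [0..<length p - 1]"

lemma descent_word_eq: "descent_word lab rel p = prod_list (map ab_var (descent_letters lab rel p))"
  by (simp add: descent_word_def descent_letters_def comp_def if_distrib)

text \<open>A nonempty path has one arc more than its word has letters, so \<open>i\<close> letters
  belong to \<open>Suc i\<close> arcs. The deleted letter \<open>i\<close> compares arcs
  \<open>i\<close> and \<open>Suc i\<close>, which the cut separates.\<close>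

lemma take_descent_letters:
  assumes "i < length p - 1"
  shows "take i (descent_letters lab rel p) = descent_letters lab rel (take (Suc i) p)"
  using assms by (intro nth_equalityI) (auto simp: descent_letters_def)

lemma drop_descent_letters:
  "drop (Suc i) (descent_letters lab rel p) = descent_letters lab rel (drop (Suc i) p)"
  by (intro nth_equalityI) (auto simp: descent_letters_def)

lemma coproduct_descent_word:
  "\<Delta> (descent_word lab rel p) = (\<Sum>i<length p - 1.
    descent_word lab rel (take (Suc i) p) \<otimes> descent_word lab rel (drop (Suc i) p))"
proof -
  have "length (descent_letters lab rel p) = length p - 1"
    by (simp add: descent_letters_def)
  then show ?thesis
    by (simp add: descent_word_eq coproduct_monomial take_descent_letters drop_descent_letters)
qed

lemma coproduct_sum: "\<Delta> (\<Sum>i\<in>I. f i) = (\<Sum>i\<in>I. \<Delta> (f i))"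
  by (rule sum_comp_morphism[symmetric, unfolded comp_def])
    (simp_all add: coproduct_add, simp add: coproduct_def)

lemma tensor_sum: "(\<Sum>i\<in>I. f i) \<otimes> (\<Sum>j\<in>J. g j) = (\<Sum>i\<in>I. \<Sum>j\<in>J. f i \<otimes> g j)"
proof -
  have "(\<Sum>i\<in>I. f i) \<otimes> h = (\<Sum>i\<in>I. f i \<otimes> h)" for h
    by (rule sum_comp_morphism[symmetric, unfolded comp_def])
      (simp_all add: tensor_add_left, simp add: tensor_def)
  moreover have "h \<otimes> (\<Sum>j\<in>J. g j) = (\<Sum>j\<in>J. h \<otimes> g j)" for h
    by (rule sum_comp_morphism[symmetric, unfolded comp_def])
      (simp_all add: tensor_add_right, simp add: tensor_def)
  ultimately show ?thesis
    by (simp add: sum.swap[of _ I J])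
qed

text \<open>A nonempty closed walk would yield a cycle.\<close>

lemma (in acyclic_digraph) closed_awalk_Nil:
  assumes "awalk u p u"
  shows "p = []"
  using assms acyclic closed_w_imp_cycle[of p] by (auto simp: closed_w_def)

text \<open>Walks from \<open>x\<close> to \<open>z\<close> and from \<open>z\<close> to
  \<open>y\<close> concatenate, so \<open>z\<close> lies on one of finitely many walks, each with
  finitely many vertices.\<close>

lemma (in wf_digraph) finite_awalk_vertices:
  assumes "finite {p. awalk x p y}"
  shows "finite {z. path_le G x z \<and> path_le G z y}"
proof (rule finite_subset)
  show "{z. path_le G x z \<and> path_le G z y} \<subseteq> (\<Union>p\<in>{p. awalk x p y}. set (awalk_verts x p))"
  proof
    fix z
    assume "z \<in> {z. path_le G x z \<and> path_le G z y}"
    then obtain q r where "awalk x q z" "awalk z r y"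
      by (auto simp: path_le_def)
    moreover from this have "z \<in> set (awalk_verts x q)"
      using last_in_set[of "awalk_verts x q"] by simp
    ultimately show "z \<in> (\<Union>p\<in>{p. awalk x p y}. set (awalk_verts x p))"
      by (intro UN_I[of "q @ r"]) (auto simp: set_awalk_verts)
  qed
qed (use assms in simp)

theorem theorem3p1:
  fixes G :: "('v, 'e) pre_digraph"
    and lab :: "'e \<Rightarrow> 'l"
    and rel :: "'l \<Rightarrow> 'l \<Rightarrow> bool"
    and x y :: 'v
  assumes "acyclic_digraph G"
    and "path_less G x y"
  shows "\<Delta> (ab_index G lab rel x y) =
    (\<Sum>z | path_less G x z \<and> path_less G z y. ab_index G lab rel x z \<otimes> ab_index G lab rel z y)"
proof -
  interpret acyclic_digraph G
    by (rule assms)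
  let ?P = "\<lambda>u v. {p. awalk u p v}"
  let ?Z = "{z. path_less G x z \<and> path_less G z y}"
  let ?w = "descent_word lab rel"
  have index: "ab_index G lab rel u v = sum ?w (?P u v)" for u v
    by (simp add: ab_index_def awalk_interval_iff)
  have "finite ?Z"
    using finite_subset[OF _ finite_awalk_vertices[OF locally_finite, of x y], of ?Z]
    by (auto simp: path_less_def)
  have cut: "awalk x (take (Suc i) p) (awlast x (take (Suc i) p))"
    "awalk (awlast x (take (Suc i) p)) (drop (Suc i) p) y"
    if "awalk x p y" for p i
    using that awalk_append_iff[of x "take (Suc i) p" "drop (Suc i) p" y] by auto
  \<comment> \<open>Acyclicity enters here: a nonempty path cannot return to its start.\<close>
  have less: "path_less G u v" if "awalk u p v" "p \<noteq> []" for u p v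
    using that closed_awalk_Nil by (auto simp: path_less_def path_le_def)
  have length_pos: "0 < length p" if "awalk u p v" "path_less G u v" for u p v
    using that by (auto simp: path_less_def awalk_Nil_iff)
  have "\<Delta> (ab_index G lab rel x y)
      = (\<Sum>p\<in>?P x y. \<Sum>i<length p - 1. ?w (take (Suc i) p) \<otimes> ?w (drop (Suc i) p))"
    by (simp add: index coproduct_sum coproduct_descent_word)
  also have "\<dots> = (\<Sum>(p, i)\<in>(SIGMA p:?P x y. {..<length p - 1}).
      ?w (take (Suc i) p) \<otimes> ?w (drop (Suc i) p))"
    by (rule sum.Sigma) (auto simp: locally_finite)
  also have "\<dots> = (\<Sum>(z, q, r)\<in>(SIGMA z:?Z. ?P x z \<times> ?P z y). ?w q \<otimes> ?w r)"
  \<comment> \<open>Gluing \<open>q\<close> and \<open>r\<close> creates one new letter, comparing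
    the last arc of \<open>q\<close> with the first of \<open>r\<close>; counted from 0, its
    position is \<open>length q - 1\<close>.\<close>
  proof (rule sum.reindex_bij_witness[where
        i = "\<lambda>(z, q, r). (q @ r, length q - 1)" and
        j = "\<lambda>(p, i). (awlast x (take (Suc i) p), take (Suc i) p, drop (Suc i) p)"])
    fix t
    assume "t \<in> (SIGMA z:?Z. ?P x z \<times> ?P z y)"
    then obtain z q r where t: "t = (z, q, r)" and q: "awalk x q z" and r: "awalk z r y"
      and z: "path_less G x z" "path_less G z y"
      by auto
    \<comment> \<open>Both pieces are nonempty because their ends differ; this rules out truncated
      subtraction and puts the joint in range.\<close>
    have len: "Suc (length q - Suc 0) = length q" "length q - Suc 0 < length q + length r - Suc 0"
      using length_pos[OF q z(1)] length_pos[OF r z(2)] by linarith+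
    show "(case case t of (z, q, r) \<Rightarrow> (q @ r, length q - 1) of (p, i) \<Rightarrow>
        (awlast x (take (Suc i) p), take (Suc i) p, drop (Suc i) p)) = t"
      using q len by (simp add: t)
    show "(case t of (z, q, r) \<Rightarrow> (q @ r, length q - 1)) \<in> (SIGMA p:?P x y. {..<length p - 1})"
      using q r len by (auto simp: t)
  next
    fix t
    assume "t \<in> (SIGMA p:?P x y. {..<length p - 1})"
    then show "(case t of (p, i) \<Rightarrow> (awlast x (take (Suc i) p), take (Suc i) p, drop (Suc i) p))
        \<in> (SIGMA z:?Z. ?P x z \<times> ?P z y)"
      \<comment> \<open>The bound \<open>i < length p - 1\<close> leaves an arc on each side of the
        cut, so both inequalities are strict.\<close>
      by (auto intro!: cut less[OF cut(1)] less[OF cut(2)])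
  qed auto
  also have "\<dots> = (\<Sum>z\<in>?Z. \<Sum>(q, r)\<in>?P x z \<times> ?P z y. ?w q \<otimes> ?w r)"
    by (rule sum.Sigma[symmetric]) (auto simp: \<open>finite ?Z\<close> locally_finite)
  also have "\<dots> = (\<Sum>z\<in>?Z. ab_index G lab rel x z \<otimes> ab_index G lab rel z y)"
    \<comment> \<open>Bilinearity turns the sum over pairs of paths into a tensor of two
      sums.\<close>
    by (simp add: index tensor_sum sum.cartesian_product)
  finally show ?thesis .
qed

end
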